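(* Let $M$ be a manifold and let $U\subset M$ be a weakly sorted neighborhood containing the point $x$. Suppose that for each $y\in NH(x)$ there is a continuous map $h:M\to M$ such that $h(y)=x$ and the restriction of $h$ to $\{x\}\cup NH(x)$ is injective. Then $NH(x)$ is discrete.
   Context: A manifold is a connected topological space each of whose points has a neighborhood homeomorphic to $\mathbb{R}^n$ for some fixed integer $n$ (not assumed Hausdorff). Two points are separated if they have disjoint open neighborhoods; $NH(x)$ is the set of points $y\neq x$ of $M$ which cannot be separated from $x$. An open Hausdorff subset $U$ of $M$ is weakly sorted (is a weakly sorted neighborhood) if there are a Hausdorff space $H$ and a continuous map $f:\overline{U}\to H$ such that the restriction of $f$ to $U$ is finite-to-one. Discreteness is with respect to the subspace topology. *)

theory Defs
  imports "HOL-Analysis.Analysis"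
begin

text \<open>Manifolds are not assumed to be Hausdorff (nor second countable). A neighborhood of a point
  is any set containing an open set around it; for the locally Euclidean condition it makes
  no difference to ask for open neighborhoods only.\<close>

definition manifold :: "'a topology \<Rightarrow> bool" where
  "manifold M \<longleftrightarrow> connected_space M \<and>
     (\<exists>n. \<forall>x \<in> topspace M. \<exists>V W. openin M V \<and> x \<in> V \<and> V \<subseteq> W \<and> W \<subseteq> topspace M \<and>
            subtopology M W homeomorphic_space Euclidean_space n)"

definition separated_points :: "'a topology \<Rightarrow> 'a \<Rightarrow> 'a \<Rightarrow> bool" where
  "separated_points M x y \<longleftrightarrow>
     (\<exists>V W. openin M V \<and> openin M W \<and> x \<in> V \<and> y \<in> W \<and> disjnt V W)"

definition NH :: "'a topology \<Rightarrow> 'a \<Rightarrow> 'a set" where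
  "NH M x = {y \<in> topspace M. y \<noteq> x \<and> \<not> separated_points M x y}"

text \<open>HOL cannot quantify existentially over the carrier type of the Hausdorff space \<open>H\<close>, so
  that type is a parameter. A theorem assuming \<open>weakly_sorted TYPE('h) M U\<close> for a free type
  variable \<open>'h\<close> covers Hausdorff spaces over every type.\<close>

definition weakly_sorted :: "'h itself \<Rightarrow> 'a topology \<Rightarrow> 'a set \<Rightarrow> bool" where
  "weakly_sorted T M U \<longleftrightarrow>
     openin M U \<and> Hausdorff_space (subtopology M U) \<and>
     (\<exists>(H :: 'h topology) f.
        Hausdorff_space H \<and>
        continuous_map (subtopology M (M closure_of U)) H f \<and>
        (\<forall>p \<in> topspace H. finite {u \<in> U. f u = p}))"

end

theory Submission imports Defs begin

text \<open>Continuous maps preserve inseparability, and a continuous map to a Hausdorff space identifies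
  inseparable points. The points of \<open>NH M x\<close> cannot be told apart from \<open>x\<close> by open sets, so they
  all lie in the closure of \<open>U\<close> and the sorting map \<open>f\<close> sends them all to \<open>f x\<close>. This puts no
  restriction on their number, since finiteness of the fibres is known only inside \<open>U\<close>, which
  contains no point of \<open>NH M x\<close>.

  The self-maps of \<open>M\<close> bring the points of \<open>NH M x\<close> into \<open>U\<close>. Let \<open>y\<close> be one of them and let \<open>h\<close> carry
  \<open>y\<close> to \<open>x\<close>. Then \<open>h x\<close> is inseparable from \<open>h y = x\<close>, so \<open>f (h x) = f x\<close>. Every
  \<open>z \<in> NH M x\<close> near \<open>y\<close> has \<open>h z \<in> U\<close>, and \<open>h z\<close> is inseparable from \<open>h x\<close>; hence
  \<open>f (h z) = f (h x) = f x\<close>. So \<open>h\<close> maps the part of \<open>NH M x\<close> near \<open>y\<close> injectively into one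
  finite fibre of \<open>f\<close> on \<open>U\<close>. Thus \<open>y\<close> has a neighborhood with only finitely many points of
  \<open>NH M x\<close>, and a manifold, being locally Euclidean, is a T1 space, so \<open>y\<close> is isolated
  in \<open>NH M x\<close>.\<close>

lemma separated_points_commute: "separated_points M x y \<longleftrightarrow> separated_points M y x"
  unfolding separated_points_def using disjnt_sym by blast

text \<open>Disjoint neighborhoods of the images would pull back to disjoint neighborhoods.\<close>

lemma not_separated_points_continuous_image:
  assumes "continuous_map M N h" "x \<in> topspace M" "y \<in> topspace M" "\<not> separated_points M x y"
  shows "\<not> separated_points N (h x) (h y)"
proof
  assume "separated_points N (h x) (h y)"
  then obtain V W where VW: "openin N V" "openin N W" "h x \<in> V" "h y \<in> W" "disjnt V W"
    unfolding separated_points_def by blast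
  let ?V = "{u \<in> topspace M. h u \<in> V}" and ?W = "{u \<in> topspace M. h u \<in> W}"
  have "openin M ?V" "openin M ?W"
    using assms(1) VW by (auto intro: openin_continuous_map_preimage)
  moreover have "x \<in> ?V" "y \<in> ?W" "disjnt ?V ?W"
    using VW assms by (auto simp: disjnt_iff)
  ultimately show False
    using assms(4) unfolding separated_points_def by blast
qed

lemma not_separated_from_open_imp_closure_of:
  assumes "openin M U" "x \<in> U" "y \<in> topspace M" "\<not> separated_points M x y"
  shows "y \<in> M closure_of U"
  using assms unfolding separated_points_def in_closure_of disjnt_iff by blast

text \<open>Inseparability in \<open>M\<close> need not survive in a subspace. It does here because \<open>x\<close> lies in the open
  set \<open>U\<close>: shrinking neighborhoods of \<open>x\<close> into \<open>U\<close> makes them meet those of \<open>y\<close> inside the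
  subspace.\<close>

lemma not_separated_points_subtopology_closure_of:
  assumes "openin M U" "x \<in> U" "\<not> separated_points M x y"
  shows "\<not> separated_points (subtopology M (M closure_of U)) x y"
proof
  assume "separated_points (subtopology M (M closure_of U)) x y"
  then obtain V W where VW: "openin M V" "openin M W" "x \<in> V" "y \<in> W"
      and dis: "disjnt (V \<inter> M closure_of U) (W \<inter> M closure_of U)"
    unfolding separated_points_def openin_subtopology by auto
  have "openin M (V \<inter> U)" "x \<in> V \<inter> U"
    using VW assms by auto
  then obtain u where "u \<in> V" "u \<in> U" "u \<in> W"
    using VW assms(3) unfolding separated_points_def disjnt_iff by blast
  moreover have "U \<subseteq> M closure_of U"
    using assms(1) by (simp add: closure_of_subset openin_subset)
  ultimately show False
    using dis by (auto simp: disjnt_iff)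
qed

lemma continuous_map_Hausdorff_eq_if_not_separated:
  assumes "openin M U" "x \<in> U" "y \<in> topspace M" "\<not> separated_points M x y"
    and H: "Hausdorff_space H" and f: "continuous_map (subtopology M (M closure_of U)) H f"
  shows "f x = f y"
proof (rule ccontr)
  assume "f x \<noteq> f y"
  have x: "x \<in> topspace (subtopology M (M closure_of U))"
    using closure_of_subset[OF openin_subset[OF assms(1)]] openin_subset[OF assms(1)] assms(2)
    by auto
  have y: "y \<in> topspace (subtopology M (M closure_of U))"
    using not_separated_from_open_imp_closure_of[OF assms(1-4)] assms(3) by simp
  have "f x \<in> topspace H" "f y \<in> topspace H"
    using f x y by (auto simp: continuous_map_def)
  then have "separated_points H (f x) (f y)"
    using H \<open>f x \<noteq> f y\<close> unfolding Hausdorff_space_def separated_points_def by blast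
  then show False
    using not_separated_points_continuous_image[OF f x y]
      not_separated_points_subtopology_closure_of[OF assms(1,2,4)] by blast
qed

lemma manifold_imp_t1_space:
  assumes "manifold M"
  shows "t1_space M"
  unfolding t1_space_def
proof (intro ballI impI)
  fix x y assume xy: "x \<in> topspace M" "y \<in> topspace M" "x \<noteq> y"
  obtain n V W where VW: "openin M V" "x \<in> V" "V \<subseteq> W"
      and hom: "subtopology M W homeomorphic_space Euclidean_space n"
    using assms xy(1) unfolding manifold_def by blast
  have "Hausdorff_space (subtopology M W)"
    using hom Hausdorff_Euclidean_space homeomorphic_Hausdorff_space by blast
  then have "Hausdorff_space (subtopology M V)"
    using VW(3) Hausdorff_space_subtopology[of "subtopology M W" V]
    by (simp add: subtopology_subtopology inf_absorb2)
  then have t1: "t1_space (subtopology M V)"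
    by (rule Hausdorff_imp_t1_space)
  show "\<exists>O'. openin M O' \<and> x \<in> O' \<and> y \<notin> O'"
  proof (cases "y \<in> V")
    case True
    then obtain O' where "openin (subtopology M V) O'" "x \<in> O'" "y \<notin> O'"
      using t1 xy VW(2) unfolding t1_space_def by (metis IntI topspace_subtopology)
    then show ?thesis
      using openin_trans_full[OF _ VW(1)] by blast
  next
    case False
    then show ?thesis using VW by blast
  qed
qed

lemma openin_singleton_if_finite_neighborhood:
  assumes "t1_space M" "openin M G" "y \<in> G" "y \<in> S" "finite (G \<inter> S)"
  shows "openin (subtopology M S) {y}"
proof -
  have "closedin M (G \<inter> S - {y})"
    using assms(1,2,5) openin_subset[OF assms(2)] by (auto simp: t1_space_closedin_finite)
  then have "openin M (G - (G \<inter> S - {y}))"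
    using assms(2) by (rule openin_diff[rotated])
  moreover have "{y} = (G - (G \<inter> S - {y})) \<inter> S"
    using assms(3,4) by blast
  ultimately show ?thesis
    unfolding openin_subtopology by blast
qed

theorem proposition4p4:
  fixes M :: "'a topology" and U :: "'a set" and x :: 'a
  assumes "manifold M"
    and "weakly_sorted TYPE('h) M U"
    and "x \<in> U"
    and "\<And>y. y \<in> NH M x \<Longrightarrow>
           \<exists>h. continuous_map M M h \<and> h y = x \<and> inj_on h ({x} \<union> NH M x)"
  shows "subtopology M (NH M x) = discrete_topology (NH M x)"
proof -
  from assms(2) obtain H :: "'h topology" and f
    where U: "openin M U" and H: "Hausdorff_space H"
      and f: "continuous_map (subtopology M (M closure_of U)) H f"
      and fin: "\<And>p. p \<in> topspace H \<Longrightarrow> finite {u \<in> U. f u = p}"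
    unfolding weakly_sorted_def by blast
  note f_eq = continuous_map_Hausdorff_eq_if_not_separated[OF U _ _ _ H f]
  have xM: "x \<in> topspace M"
    using U assms(3) openin_subset by blast
  have "x \<in> topspace (subtopology M (M closure_of U))"
    using closure_of_subset[OF openin_subset[OF U]] assms(3) xM by auto
  then have "f x \<in> topspace H"
    using f by (auto simp: continuous_map_def)
  then have fibre: "finite {u \<in> U. f u = f x}"
    by (rule fin)
  have "openin (subtopology M (NH M x)) {y}" if y: "y \<in> NH M x" for y
  proof -
    obtain h where h: "continuous_map M M h" "h y = x" and inj: "inj_on h ({x} \<union> NH M x)"
      using assms(4)[OF y] by blast
    define G where "G = {u \<in> topspace M. h u \<in> U}"
    have hM: "h z \<in> topspace M" if "z \<in> topspace M" for z
      using h(1) that by (auto simp: continuous_map_def)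
    have h_NH: "\<not> separated_points M (h z) (h x)" if "z \<in> NH M x" for z
      using not_separated_points_continuous_image[OF h(1), of z x] that xM
      by (auto simp: NH_def separated_points_commute)
    have fhx: "f x = f (h x)"
      using f_eq[OF assms(3) hM[OF xM]] h_NH[OF y] h(2) by simp
    have "h ` (G \<inter> NH M x) \<subseteq> {u \<in> U. f u = f x}"
      using f_eq[OF _ hM[OF xM] h_NH] fhx by (auto simp: G_def)
    then have "finite (h ` (G \<inter> NH M x))"
      using fibre by (rule finite_subset)
    moreover have "inj_on h (G \<inter> NH M x)"
      using inj by (rule inj_on_subset) blast
    ultimately have "finite (G \<inter> NH M x)"
      by (rule finite_imageD)
    moreover have "openin M G"
      unfolding G_def using h(1) U by (rule openin_continuous_map_preimage)
    moreover have "y \<in> G"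
      using y h(2) assms(3) by (simp add: G_def NH_def)
    ultimately show ?thesis
      using openin_singleton_if_finite_neighborhood[OF manifold_imp_t1_space[OF assms(1)]] y
      by blast
  qed
  moreover have "topspace (subtopology M (NH M x)) = NH M x"
    by (auto simp: NH_def)
  ultimately show ?thesis
    by (metis discrete_topology_unique)
qed

end
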